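(* Let $1\leq k\leq n$ and let $\Lambda_1,\dots,\Lambda_d\subset\mathbb{P}^n$ be $(k-1)$-dimensional linear subspaces satisfying $\mathrm{SP}(n-k)$. Let $2\leq r\leq\min\{d-2,\,n-k+1\}$ be an integer such that for a general point $p\in\Lambda_d$ (i.e. for all $p$ in a nonempty Zariski open subset of $\Lambda_d$) one has $p\notin\Lambda_i$ for $i=1,\dots,r$, and the $(k-1)$-planes $\Gamma_i:=\pi_p(\Lambda_i)\subset\mathbb{P}^{n-1}$, $i=1,\dots,r$, satisfy $\mathrm{SP}(n-k-1)$, where $\pi_p\colon\mathbb{P}^n\dashrightarrow\mathbb{P}^{n-1}$ is the projection from $p$. Then one of the following holds: (A) $\Lambda_d\subset\mathrm{Span}(\Lambda_1,\dots,\Lambda_r)$; (B) $\Lambda_1,\dots,\Lambda_r$ satisfy $\mathrm{SP}(n-k)$.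
   Context: For $(k-1)$-dimensional linear subspaces $\Lambda_1,\dots,\Lambda_e\subset\mathbb{P}^N$ (not necessarily distinct), $\mathrm{SP}(N-k)$ means: for every $j\in\{1,\dots,e\}$ and every $(N-k)$-dimensional linear subspace $L\subset\mathbb{P}^N$ meeting each $\Lambda_i$ with $i\neq j$, $L$ also meets $\Lambda_j$. *)

theory Defs
  imports "HOL-Analysis.Analysis"
begin

text \<open>Projective space P^N over the complex numbers is modelled by the vector space
  complex^'n with CARD('n) = N+1.  A projective linear subspace of projective dimension m
  is a (complex) linear subspace of vector dimension m+1; a point is a nonzero vector.\<close>

definition pspace :: "nat \<Rightarrow> (complex^'n) set \<Rightarrow> bool" where
  "pspace m S \<longleftrightarrow> vec.subspace S \<and> vec.dim S = m + 1"

text \<open>Two projective subspaces meet iff the vector subspaces share a nonzero vector.\<close>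
definition meets :: "(complex^'n) set \<Rightarrow> (complex^'n) set \<Rightarrow> bool" where
  "meets A B \<longleftrightarrow> (\<exists>v. v \<noteq> 0 \<and> v \<in> A \<and> v \<in> B)"

text \<open>SP(m) for the family Lambda_1, ..., Lambda_e.\<close>
definition SP :: "nat \<Rightarrow> nat \<Rightarrow> (nat \<Rightarrow> (complex^'n) set) \<Rightarrow> bool" where
  "SP m e Lam \<longleftrightarrow>
     (\<forall>j\<in>{1..e}. \<forall>L. pspace m L \<and> (\<forall>i\<in>{1..e}. i \<noteq> j \<longrightarrow> meets L (Lam i))
        \<longrightarrow> meets L (Lam j))"

text \<open>Polynomial functions on complex^'n (in the coordinates).\<close>
inductive_set polyfun :: "(complex^'n \<Rightarrow> complex) set" where
  const: "(\<lambda>v. c) \<in> polyfun"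
| coord: "(\<lambda>v. v $ i) \<in> polyfun"
| add: "f \<in> polyfun \<Longrightarrow> g \<in> polyfun \<Longrightarrow> (\<lambda>v. f v + g v) \<in> polyfun"
| mult: "f \<in> polyfun \<Longrightarrow> g \<in> polyfun \<Longrightarrow> (\<lambda>v. f v * g v) \<in> polyfun"

definition homogeneous_polyfun :: "(complex^'n \<Rightarrow> complex) \<Rightarrow> bool" where
  "homogeneous_polyfun f \<longleftrightarrow> f \<in> polyfun \<and> (\<exists>d::nat. \<forall>c v. f (c *s v) = c ^ d * f v)"

text \<open>(Affine cones over) Zariski closed subsets of projective space: common zero
  loci of families of homogeneous polynomials.\<close>
definition zariski_closed :: "(complex^'n) set \<Rightarrow> bool" where
  "zariski_closed Z \<longleftrightarrow>
     (\<exists>F. (\<forall>f\<in>F. homogeneous_polyfun f) \<and> Z = {v. \<forall>f\<in>F. f v = 0})"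

text \<open>P holds for a general point of the projective subspace S: there is a nonempty
  Zariski open subset U = S - Z of S (Z Zariski closed) such that P p for all points p in U.\<close>
definition general_point :: "(complex^'n) set \<Rightarrow> (complex^'n \<Rightarrow> bool) \<Rightarrow> bool" where
  "general_point S P \<longleftrightarrow>
     (\<exists>Z. zariski_closed Z \<and> (\<exists>v\<in>S. v \<noteq> 0 \<and> v \<notin> Z) \<and>
          (\<forall>p\<in>S. p \<noteq> 0 \<and> p \<notin> Z \<longrightarrow> P p))"

text \<open>A projection from the point p onto P^{N-1} (= projective space of complex^'m,
  CARD('m) = N): a surjective linear map whose kernel is the line spanned by p.\<close>
definition projection_from :: "complex^'n \<Rightarrow> (complex^'n \<Rightarrow> complex^'m) \<Rightarrow> bool" where
  "projection_from p f \<longleftrightarrow> Vector_Spaces.linear (*s) (*s) f \<and> surj f \<and>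
     {v. f v = 0} = vec.span {p}"

end

theory Submission
  imports Defs "HOL-Computational_Algebra.Polynomial"
begin

text \<open>If \<open>\<Lambda>\<^sub>d\<close> is not contained in \<open>W = Span(\<Lambda>\<^sub>1, ..., \<Lambda>\<^sub>r)\<close>, a general point \<open>p\<close> of
  \<open>\<Lambda>\<^sub>d\<close> lies outside \<open>W\<close> (two nonempty Zariski open subsets of \<open>\<Lambda>\<^sub>d\<close> meet, as seen on a
  line). Suppose an \<open>(n-k)\<close>-plane \<open>L\<close> meets every \<open>\<Lambda>\<^sub>i\<close>, \<open>i \<noteq> j\<close>, but misses \<open>\<Lambda>\<^sub>j\<close>. The span of
  \<open>p\<close> and one intersection point of \<open>L\<close> with each \<open>\<Lambda>\<^sub>i\<close>, \<open>i \<noteq> j\<close>, has projective dimension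
  at most \<open>r - 1 \<le> n - k\<close>, and it still misses \<open>\<Lambda>\<^sub>j\<close> because \<open>p \<notin> W\<close>; enlarge it to an
  \<open>(n-k)\<close>-plane \<open>L'\<close> through \<open>p\<close> missing \<open>\<Lambda>\<^sub>j\<close>. Since \<open>p \<in> L'\<close>, the projection from \<open>p\<close>
  maps \<open>L'\<close> to an \<open>(n-k-1)\<close>-plane that meets \<open>\<Gamma>\<^sub>i\<close> for \<open>i \<noteq> j\<close> but misses \<open>\<Gamma>\<^sub>j\<close>,
  contradicting \<open>SP(n-k-1)\<close> for the \<open>\<Gamma>\<^sub>i\<close>.\<close>

lemma vec_subspace_scale_iff:
  fixes x :: "complex^'n"
  assumes "vec.subspace W" "c \<noteq> 0"
  shows "c *s x \<in> W \<longleftrightarrow> x \<in> W"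
  by (metis assms vec.scale_one vec.scale_scale field_class.field_inverse vec.subspace_scale)

lemma subspace_line_finite:
  fixes a b :: "complex^'n"
  assumes W: "vec.subspace W" and b: "b \<notin> W"
  shows "finite {t. a + t *s b \<in> W}"
proof -
  have "s = t" if "a + s *s b \<in> W" "a + t *s b \<in> W" for s t
  proof (rule ccontr)
    assume "s \<noteq> t"
    have "(a + s *s b) - (a + t *s b) \<in> W" using that W vec.subspace_diff by blast
    moreover have "(a + s *s b) - (a + t *s b) = (s - t) *s b" by (simp add: vec.scale_left_diff_distrib)
    ultimately have "(s - t) *s b \<in> W" by simp
    thus False using b vec_subspace_scale_iff[OF W] \<open>s \<noteq> t\<close> by (metis right_minus_eq)
  qed
  hence "\<exists>s. {t. a + t *s b \<in> W} \<subseteq> {s}" by blast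
  thus ?thesis using finite_subset by blast
qed

lemma polyfun_on_line:
  fixes f :: "complex^'n \<Rightarrow> complex" and a b :: "complex^'n"
  assumes "f \<in> polyfun"
  obtains P where "\<And>t. f (a + t *s b) = poly P t"
proof -
  from assms have "\<exists>P. \<forall>t. f (a + t *s b) = poly P t"
  proof induction
    case (const c) show ?case by (intro exI[of _ "[:c:]"]) simp
  next
    case (coord i) show ?case by (intro exI[of _ "[:a$i, b$i:]"]) (simp add: algebra_simps)
  next
    case (add f g) thus ?case by (metis poly_add)
  next
    case (mult f g) thus ?case by (metis poly_mult)
  qed
  thus ?thesis using that by blast
qed

lemma zariski_closed_line_finite:
  fixes a b :: "complex^'n"
  assumes Z: "zariski_closed Z" and a: "a \<notin> Z"
  shows "finite {t. a + t *s b \<in> Z}"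
proof -
  obtain F where F: "\<forall>f\<in>F. homogeneous_polyfun f" and Z_eq: "Z = {v. \<forall>f\<in>F. f v = 0}"
    using Z unfolding zariski_closed_def by blast
  obtain f where f: "f \<in> F" "f a \<noteq> 0" using a Z_eq by blast
  have "f \<in> polyfun" using F f(1) unfolding homogeneous_polyfun_def by blast
  then obtain P where P: "\<And>t. f (a + t *s b) = poly P t" using polyfun_on_line by blast
  have "P \<noteq> 0" using P[of 0] f(2) by auto
  moreover have "{t. a + t *s b \<in> Z} \<subseteq> {t. poly P t = 0}" using P f(1) Z_eq by auto
  ultimately show ?thesis using poly_roots_finite finite_subset by blast
qed

lemma general_point_avoiding_subspace:
  fixes S W :: "(complex^'n) set"
  assumes gen: "general_point S P" and S: "vec.subspace S" and W: "vec.subspace W"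
    and "\<not> S \<subseteq> W"
  obtains p where "p \<in> S" "p \<notin> W" "P p"
proof -
  obtain Z a where Z: "zariski_closed Z" and a: "a \<in> S" "a \<notin> Z"
    and P: "\<And>p. p \<in> S \<Longrightarrow> p \<noteq> 0 \<Longrightarrow> p \<notin> Z \<Longrightarrow> P p"
    using gen unfolding general_point_def by blast
  obtain b where b: "b \<in> S" "b \<notin> W" using \<open>\<not> S \<subseteq> W\<close> by blast
  have "finite ({t. a + t *s b \<in> Z} \<union> {t. a + t *s b \<in> W})"
    using zariski_closed_line_finite[OF Z a(2)] subspace_line_finite[OF W b(2)] by blast
  then obtain t where t: "a + t *s b \<notin> Z" "a + t *s b \<notin> W"
    using ex_new_if_finite[OF infinite_UNIV_char_0] by blast
  have "a + t *s b \<in> S" using S a(1) b(1) by (simp add: vec.subspace_add vec.subspace_scale)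
  moreover have "a + t *s b \<noteq> 0" using t(2) W vec.subspace_0 by metis
  ultimately show ?thesis using that P t by blast
qed

lemma not_meets_span_insert:
  fixes u :: "complex^'n"
  assumes W: "vec.subspace W" and u: "u \<notin> W" and "S \<subseteq> W" "B \<subseteq> W"
    and "\<not> meets (vec.span S) B"
  shows "\<not> meets (vec.span (insert u S)) B"
proof
  assume "meets (vec.span (insert u S)) B"
  then obtain x where x: "x \<noteq> 0" "x \<in> vec.span (insert u S)" "x \<in> B" unfolding meets_def by blast
  then obtain c where c: "x - c *s u \<in> vec.span S" using vec.span_breakdown_eq by blast
  show False
  proof (cases "c = 0")
    case True
    thus False using x c \<open>\<not> meets (vec.span S) B\<close> unfolding meets_def by auto
  next
    case False
    have "x - c *s u \<in> W" using c \<open>S \<subseteq> W\<close> W vec.span_minimal by blast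
    hence "x - (x - c *s u) \<in> W" using x(3) \<open>B \<subseteq> W\<close> W vec.subspace_diff by blast
    thus False using u False vec_subspace_scale_iff[OF W] by simp
  qed
qed

lemma vec_dim_Un_le:
  fixes A B :: "(complex^'n) set"
  assumes "vec.subspace A" "vec.subspace B"
  shows "vec.dim (A \<union> B) \<le> vec.dim A + vec.dim B"
proof -
  have span_eq: "vec.span A = A" "vec.span B = B" using assms by simp_all
  have "vec.span (A \<union> B) = {x + y |x y. x \<in> A \<and> y \<in> B}"
    using vec.span_Un[of A B] unfolding span_eq .
  hence "vec.dim (A \<union> B) = vec.dim {x + y |x y. x \<in> A \<and> y \<in> B}"
    by (metis vec.dim_span)
  thus ?thesis using vec.dim_sums_Int[OF assms] by linarith
qed

lemma subspace_extend_not_meets: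
  fixes A B :: "(complex^'n) set"
  assumes "vec.subspace A" "vec.subspace B" "\<not> meets A B" "vec.dim A \<le> m"
    "m + vec.dim B \<le> CARD('n)"
  shows "\<exists>L. vec.subspace L \<and> A \<subseteq> L \<and> vec.dim L = m \<and> \<not> meets L B"
  using assms
proof (induction "m - vec.dim A" arbitrary: A)
  case 0
  then show ?case by (intro exI[of _ A]) auto
next
  case (Suc e)
  have "vec.dim (A \<union> B) < vec.dim (UNIV :: (complex^'n) set)"
    using vec_dim_Un_le[OF Suc(3,4)] Suc(2,7) by (simp add: card_cart_basis)
  then obtain u where u: "u \<notin> vec.span (A \<union> B)" by (metis UNIV_I subsetI vec.dim_span vec.dim_subset leD)
  define A' where "A' = vec.span (insert u A)"
  have "u \<notin> vec.span A" using u vec.span_mono[of A "A \<union> B"] by blast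
  hence dim_A': "vec.dim A' = vec.dim A + 1" unfolding A'_def by (simp add: vec.dim_insert)
  have "A \<union> B \<subseteq> vec.span (A \<union> B)" by (rule vec.span_superset)
  hence "\<not> meets A' B" unfolding A'_def
    using not_meets_span_insert[OF vec.subspace_span u] Suc(3,5) vec.span_eq_iff by (metis Un_subset_iff)
  then obtain L where "vec.subspace L" "A' \<subseteq> L" "vec.dim L = m" "\<not> meets L B"
    using Suc(1)[of A'] Suc(2,4,6,7) dim_A' unfolding A'_def by fastforce
  moreover have "A \<subseteq> A'" unfolding A'_def using vec.span_superset by blast
  ultimately show ?case by blast
qed

lemma basis_through_nonzero:
  fixes p :: "complex^'n"
  assumes S: "vec.subspace S" and p: "p \<in> S" "p \<noteq> 0"
  obtains B where "p \<notin> vec.span B" "vec.independent B" "vec.span (insert p B) = S"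
proof -
  have "vec.independent {p}" using p(2) by (simp add: vec.independent_insert)
  then obtain B0 where B0: "p \<in> B0" "B0 \<subseteq> S" "vec.independent B0" "S \<subseteq> vec.span B0"
    using p(1) vec.maximal_independent_subset_extend[of "{p}" S] by auto
  have "insert p (B0 - {p}) = B0" using B0(1) by blast
  moreover have "vec.span B0 = S" using B0(2,4) S by (rule vec.span_subspace)
  ultimately show ?thesis using that[of "B0 - {p}"] B0(3) by (metis Diff_iff insertI1 vec.independent_insert)
qed

lemma projection_from_linear:
  "projection_from p f \<Longrightarrow> Vector_Spaces.linear (*s) (*s) f"
  unfolding projection_from_def by blast

lemma projection_from_kernel:
  assumes "projection_from p f"
  shows "f x = 0 \<longleftrightarrow> (\<exists>c. x = c *s p)"
proof -
  have "f x = 0 \<longleftrightarrow> x \<in> vec.span {p}" using assms unfolding projection_from_def by blast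
  thus ?thesis by (auto simp: vec.span_singleton)
qed

lemma dim_image_projection:
  fixes f :: "complex^'n \<Rightarrow> complex^'m"
  assumes f: "projection_from p f" and S: "vec.subspace S" and p: "p \<in> S" "p \<noteq> 0"
  shows "vec.dim (f ` S) + 1 = vec.dim S"
proof -
  interpret lf: Vector_Spaces.linear "(*s)" "(*s)" f using f by (rule projection_from_linear)
  obtain B where B: "p \<notin> vec.span B" "vec.independent B" "vec.span (insert p B) = S"
    using basis_through_nonzero[OF S p] .
  have "f p = 0" using projection_from_kernel[OF f] by (metis vec.scale_one)
  hence "f ` S = vec.span (insert 0 (f ` B))" using B(3) lf.span_image by (metis image_insert)
  hence dim_image: "vec.dim (f ` S) = vec.dim (f ` B)" by (metis vec.dim_span vec.span_insert_0)
  have "inj_on f (vec.span B)"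
  proof (rule inj_onI)
    fix x y assume xy: "x \<in> vec.span B" "y \<in> vec.span B" "f x = f y"
    then obtain c where c: "x - y = c *s p" using projection_from_kernel[OF f] by (metis lf.diff right_minus_eq)
    have "c *s p \<in> vec.span B" unfolding c[symmetric] using xy vec.span_diff by blast
    hence "c = 0" using B(1) vec_subspace_scale_iff[OF vec.subspace_span] by blast
    thus "x = y" using c by simp
  qed
  hence "vec.dim (f ` B) = vec.dim B" by (rule vec.dim_image_eq[OF lf.linear_axioms])
  moreover have "vec.dim S = vec.dim B + 1" using B by (metis vec.dim_insert vec.dim_span)
  ultimately show ?thesis using dim_image by simp
qed

lemma projection_from_exists:
  fixes p :: "complex^'n"
  assumes p: "p \<noteq> 0" and dims: "CARD('n) = CARD('m) + 1"
  obtains f :: "complex^'n \<Rightarrow> complex^'m" where "projection_from p f"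
proof -
  obtain B where B: "p \<notin> vec.span B" "vec.independent B" "vec.span (insert p B) = UNIV"
    using basis_through_nonzero[OF vec.subspace_UNIV UNIV_I p] .
  have indep: "vec.independent (insert p B)" using B(1,2) by (rule vec.independent_insertI)
  have "p \<notin> B" using B(1) vec.span_superset by blast
  have "vec.dim (insert p B) = vec.dim (UNIV :: (complex^'n) set)" using B(3) by (metis vec.dim_span)
  hence "card B + 1 = CARD('n)"
    using vec.dim_insert[of p B] B(1,2) by (simp add: vec.dim_eq_card_independent card_cart_basis)
  hence "card B = card (cart_basis :: (complex^'m) set)" using dims by (simp add: card_cart_basis)
  then obtain h where h: "bij_betw h B (cart_basis :: (complex^'m) set)"
    using vec.finiteI_independent[OF B(2)] by (metis bij_betw_iff_card finite_cart_basis)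
  define f where "f = vec.construct (insert p B) (\<lambda>b. if b = p then 0 else h b)"
  have lin: "Vector_Spaces.linear (*s) (*s) f" unfolding f_def using indep by (rule vec.linear_construct)
  interpret lf: Vector_Spaces.linear "(*s)" "(*s)" f by fact
  have f_basis: "f p = 0" "\<And>b. b \<in> B \<Longrightarrow> f b = h b"
    unfolding f_def using indep \<open>p \<notin> B\<close> by (auto simp: vec.construct_basis)
  have f_B: "f ` B = cart_basis" and inj_B: "inj_on f B"
    using h f_basis(2) unfolding bij_betw_def by (auto cong: image_cong inj_on_cong)
  have inj: "inj_on f (vec.span B)"
    using lf.inj_on_span_iff_independent_image[of B] f_B inj_B vec.independent_Basis by simp
  have "range f = vec.span (f ` insert p B)" using B(3) lf.span_image by metis
  also have "\<dots> \<supseteq> vec.span cart_basis" using f_B by (intro vec.span_mono) auto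
  finally have "surj f" using vec.span_Basis by auto
  moreover have "{v. f v = 0} = vec.span {p}"
  proof (intro set_eqI iffI)
    fix x assume "x \<in> {v. f v = 0}"
    obtain c where c: "x - c *s p \<in> vec.span B" using B(3) vec.span_breakdown_eq by blast
    have "f (x - c *s p) = f 0" using \<open>x \<in> {v. f v = 0}\<close> f_basis(1) by (simp add: lf.diff lf.scale)
    hence "x - c *s p = 0" using inj c vec.span_zero unfolding inj_on_def by blast
    thus "x \<in> vec.span {p}" by (auto simp: vec.span_singleton)
  qed (auto simp: vec.span_singleton lf.scale f_basis(1))
  ultimately show ?thesis using that lin unfolding projection_from_def by blast
qed

lemma projection_meets_image_iff:
  fixes f :: "complex^'n \<Rightarrow> complex^'m"
  assumes f: "projection_from p f" and A: "vec.subspace A" "p \<in> A"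
    and B: "vec.subspace B" "p \<notin> B"
  shows "meets (f ` A) (f ` B) \<longleftrightarrow> meets A B"
proof
  interpret lf: Vector_Spaces.linear "(*s)" "(*s)" f using f by (rule projection_from_linear)
  assume "meets (f ` A) (f ` B)"
  then obtain a b where ab: "a \<in> A" "b \<in> B" "f a = f b" "f b \<noteq> 0" unfolding meets_def by auto
  obtain c where "a - b = c *s p" using ab(3) projection_from_kernel[OF f] by (metis lf.diff right_minus_eq)
  hence "b = a - c *s p" by (simp add: algebra_simps)
  hence "b \<in> A" using A ab(1) by (simp add: vec.subspace_diff vec.subspace_scale)
  moreover have "b \<noteq> 0" using ab(4) lf.zero by auto
  ultimately show "meets A B" unfolding meets_def using ab(2) by blast
next
  assume "meets A B"
  then obtain v where v: "v \<noteq> 0" "v \<in> A" "v \<in> B" unfolding meets_def by blast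
  have "f v \<noteq> 0"
  proof
    assume "f v = 0"
    then obtain c where "v = c *s p" using projection_from_kernel[OF f] by blast
    thus False using v B vec_subspace_scale_iff by (metis vec.scale_zero_left)
  qed
  thus "meets (f ` A) (f ` B)" unfolding meets_def using v by blast
qed

lemma SP_of_SP_projection:
  fixes Lam :: "nat \<Rightarrow> (complex^'n) set" and f :: "complex^'n \<Rightarrow> complex^'m"
  assumes f: "projection_from p f"
    and Lam: "\<And>i. i \<in> {1..r} \<Longrightarrow> vec.subspace (Lam i) \<and> m + 2 + vec.dim (Lam i) \<le> CARD('n)"
    and p: "p \<notin> vec.span (\<Union>i\<in>{1..r}. Lam i)"
    and r: "r \<le> m + 2"
    and SP_image: "SP m r (\<lambda>i. f ` Lam i)"
  shows "SP (Suc m) r Lam"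
  unfolding SP_def
proof (intro ballI allI impI)
  fix j L assume j: "j \<in> {1..r}"
    and L: "pspace (Suc m) L \<and> (\<forall>i\<in>{1..r}. i \<noteq> j \<longrightarrow> meets L (Lam i))"
  interpret lf: Vector_Spaces.linear "(*s)" "(*s)" f using f by (rule projection_from_linear)
  define W where "W = vec.span (\<Union>i\<in>{1..r}. Lam i)"
  have Lam_W: "Lam i \<subseteq> W" if "i \<in> {1..r}" for i
    unfolding W_def using that vec.span_superset by blast
  have p_Lam: "p \<notin> Lam i" if "i \<in> {1..r}" for i using Lam_W[OF that] p W_def by blast
  have "p \<noteq> 0" using p vec.span_zero by metis
  show "meets L (Lam j)"
  proof (rule ccontr)
    assume L_j: "\<not> meets L (Lam j)"
    have "\<forall>i\<in>{1..r} - {j}. \<exists>x. x \<noteq> 0 \<and> x \<in> L \<and> x \<in> Lam i"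
      using L unfolding meets_def by blast
    then obtain v where "\<forall>i\<in>{1..r} - {j}. v i \<noteq> 0 \<and> v i \<in> L \<and> v i \<in> Lam i"
      by (rule bchoice[THEN exE])
    hence v: "\<And>i. i \<in> {1..r} - {j} \<Longrightarrow> v i \<noteq> 0 \<and> v i \<in> L \<and> v i \<in> Lam i" by blast
    define A where "A = vec.span (insert p (v ` ({1..r} - {j})))"
    have "vec.dim A \<le> card (insert p (v ` ({1..r} - {j})))"
      unfolding A_def by (simp add: vec.dim_le_card vec.span_superset)
    also have "\<dots> \<le> card (v ` ({1..r} - {j})) + 1" by (simp add: card_insert_le_m1)
    also have "\<dots> \<le> r" using card_image_le[of "{1..r} - {j}" v] j by (simp; arith)
    finally have dim_A: "vec.dim A \<le> m + 2" using r by linarith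
    have "vec.span (v ` ({1..r} - {j})) \<subseteq> L"
      using v L vec.span_minimal[of "v ` ({1..r} - {j})" L] unfolding pspace_def by blast
    hence "\<not> meets A (Lam j)" unfolding A_def
      using not_meets_span_insert[of W p "v ` ({1..r} - {j})" "Lam j"] L_j v Lam_W j p
      unfolding W_def meets_def by blast
    then obtain L' where L': "vec.subspace L'" "A \<subseteq> L'" "vec.dim L' = m + 2" "\<not> meets L' (Lam j)"
      using subspace_extend_not_meets[of A "Lam j" "m + 2"] Lam[OF j] dim_A unfolding A_def by auto
    have "p \<in> A" unfolding A_def by (simp add: vec.span_base)
    hence p_L': "p \<in> L'" using L'(2) by blast
    have "pspace m (f ` L')" unfolding pspace_def
      using lf.subspace_image[OF L'(1)] dim_image_projection[OF f L'(1) p_L' \<open>p \<noteq> 0\<close>] L'(3) by simp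
    moreover have "meets (f ` L') (f ` Lam i)" if "i \<in> {1..r}" "i \<noteq> j" for i
    proof -
      have "v i \<in> A" unfolding A_def using that by (intro vec.span_base) auto
      hence "v i \<in> L'" using L'(2) by blast
      hence "meets L' (Lam i)" using v that unfolding meets_def by blast
      thus ?thesis using projection_meets_image_iff[OF f L'(1) p_L'] Lam p_Lam that by blast
    qed
    ultimately have "meets (f ` L') (f ` Lam j)" using SP_image j unfolding SP_def by blast
    thus False using projection_meets_image_iff[OF f L'(1) p_L'] Lam p_Lam j L'(4) by blast
  qed
qed

theorem lemma2p14:
  fixes Lam :: "nat \<Rightarrow> (complex^'n) set"
    and n k d r :: nat
  assumes dimN: "CARD('n) = n + 1"
    and dimM: "CARD('m) = n"
    and k1: "1 \<le> k" and kn: "k \<le> n"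
    and Lam_sub: "\<forall>i\<in>{1..d}. pspace (k - 1) (Lam i)"
    and SP_all: "SP (n - k) d Lam"
    and r2: "2 \<le> r" and rd: "r \<le> d - 2" and rnk: "r \<le> n - k + 1"
    and gen: "general_point (Lam d)
       (\<lambda>p. (\<forall>i\<in>{1..r}. p \<notin> Lam i) \<and>
            (\<forall>f :: complex^'n \<Rightarrow> complex^'m. projection_from p f \<longrightarrow>
               SP (n - k - 1) r (\<lambda>i. f ` Lam i)))"
  shows "Lam d \<subseteq> vec.span (\<Union>i\<in>{1..r}. Lam i) \<or> SP (n - k) r Lam"
proof (cases "Lam d \<subseteq> vec.span (\<Union>i\<in>{1..r}. Lam i)")
  case not_A: False
  have Lam_i: "vec.subspace (Lam i) \<and> vec.dim (Lam i) = k" if "i \<in> {1..d}" for i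
    using Lam_sub that k1 unfolding pspace_def by auto
  have "d \<in> {1..d}" using r2 rd by auto
  hence "vec.subspace (Lam d)" using Lam_i by blast
  then obtain p where p: "p \<in> Lam d" "p \<notin> vec.span (\<Union>i\<in>{1..r}. Lam i)"
    and SP_p: "\<forall>f :: complex^'n \<Rightarrow> complex^'m. projection_from p f \<longrightarrow>
               SP (n - k - 1) r (\<lambda>i. f ` Lam i)"
    by (rule general_point_avoiding_subspace[OF gen _ vec.subspace_span not_A]) blast
  have "p \<noteq> 0" using p(2) vec.span_zero by auto
  have "CARD('n) = CARD('m) + 1" using dimN dimM by simp
  then obtain f :: "complex^'n \<Rightarrow> complex^'m" where f: "projection_from p f"
    using projection_from_exists[OF \<open>p \<noteq> 0\<close>] by blast
  have "Suc (n - k - 1) = n - k" using r2 rnk by linarith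
  moreover have "SP (Suc (n - k - 1)) r Lam"
  proof (rule SP_of_SP_projection[OF f _ p(2)])
    fix i assume "i \<in> {1..r}"
    hence "i \<in> {1..d}" using rd by auto
    hence "vec.subspace (Lam i) \<and> vec.dim (Lam i) = k" by (rule Lam_i)
    thus "vec.subspace (Lam i) \<and> n - k - 1 + 2 + vec.dim (Lam i) \<le> CARD('n)"
      using dimN r2 rnk by linarith
  next
    show "r \<le> n - k - 1 + 2" using r2 rnk by linarith
    show "SP (n - k - 1) r (\<lambda>i. f ` Lam i)" using SP_p f by blast
  qed
  ultimately show ?thesis by simp
qed simp

end
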